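(* Let $d\ge2$, let $\Omega=\mathbb{R}^d$ be endowed with a continuous probability distribution function of the form $\mathbf F(\mathbf z)=F_1(z_1)\cdots F_d(z_d)$, where $F_1,\ldots,F_d$ are marginal distribution functions. Let $f:\Omega\to\mathbb{R}$ be a bounded, square-integrable function with continuous second-order partial derivatives and variance $\sigma^2=\mathrm{Var}(f)>0$ with respect to $\mathbf F$, such that all entries of the matrix $\mathbf C_{\rm gas}$ are well-defined (finite). For any $0<\epsilon<1$, and $a',b'\in\mathbb{R}$ with $a'<b'$ such that $\int_{(a',b')^d}d\mathbf F(\mathbf z)=1-\epsilon$, we have for every $m$ with $1\le m\le d-1$ and every $i=1,\ldots,d$ $$\bar S_i\le\frac{(b'-a')^2}{2}\,\frac{\gamma_i(m)+\lambda_{m+1}+\kappa}{\sigma^2},$$ where $\kappa$ is the positive constant $$\kappa=\frac{2\epsilon-\epsilon^2}{(b'-a')^2}\,\sup_{\mathbf z,\mathbf v\in\Omega}\big(f(\mathbf z)-f(\mathbf v)\big)^2,$$ $\bar S_i$ is the (generalized) upper Sobol' index of the $i$th input, $\gamma_i(m)$ is the global activity score of the $i$th parameter, and $\lambda_{m+1}$ is the $(m+1)$th eigenvalue (in descending order) of $\mathbf C_{\rm gas}$.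
   Context: Notation: for $\mathbf v,\mathbf z\in\mathbb{R}^d$, $(\mathbf v_{\{i\}}{:}\mathbf z_{-\{i\}})$ is the vector whose $i$th component is $v_i$ and whose $j$th component is $z_j$ for $j\ne i$. Generalized upper Sobol' index: $$\bar S_i=\frac{1}{2\sigma^2}\int \big(f(\mathbf z)-f(\mathbf v_{\{i\}}{:}\mathbf z_{-\{i\}})\big)^2\,d\mathbf F(\mathbf z)\,dF_i(v_i),$$ where $\sigma^2$ is the variance of $f(\mathbf z)$ for $\mathbf z\sim\mathbf F$. Global activity scores: let $\mathbf v,\mathbf z$ be independent random vectors, both with distribution $\mathbf F$. Define $$D_{\mathbf z,i}f(v_i,\mathbf z)=\frac{f(\mathbf v_{\{i\}}{:}\mathbf z_{-\{i\}})-f(\mathbf z)}{v_i-z_i},\qquad D_{\mathbf z}f(\mathbf v,\mathbf z)=[D_{\mathbf z,1}f(v_1,\mathbf z),\ldots,D_{\mathbf z,d}f(v_d,\mathbf z)]^T,$$ (defined almost surely), and the $d\times d$ symmetric positive semidefinite matrix $$\mathbf C_{\rm gas}=\mathbb{E}\big[\mathbb{E}[(D_{\mathbf z}f)(D_{\mathbf z}f)^T\mid \mathbf z]\big].$$ Let $\mathbf C_{\rm gas}=\mathbf U\Lambda\mathbf U^T$ be an eigenvalue decomposition, with $\mathbf U=[\mathbf u_1,\ldots,\mathbf u_d]$ orthogonal, $\mathbf u_j=[u_{1j},\ldots,u_{dj}]^T$, and $\Lambda=\mathrm{diag}(\lambda_1,\ldots,\lambda_d)$, $\lambda_1\ge\cdots\ge\lambda_d\ge0$.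 For $m\le d$ the global activity score of the $i$th parameter is $\gamma_i(m)=\sum_{j=1}^m\lambda_j u_{ij}^2$. *)

theory Defs
  imports "HOL-Probability.Probability"
begin

definition is_cdf :: "(real \<Rightarrow> real) \<Rightarrow> bool" where
  "is_cdf G \<longleftrightarrow> mono G \<and> (\<forall>x. continuous (at_right x) G) \<and>
     (G \<longlongrightarrow> 0) at_bot \<and> (G \<longlongrightarrow> 1) at_top"

definition joint_cdf :: "('n::finite \<Rightarrow> real \<Rightarrow> real) \<Rightarrow> real^'n \<Rightarrow> real" where
  "joint_cdf F z = (\<Prod>i\<in>UNIV. F i (z $ i))"

text \<open>The law \<open>d\<^bold>F\<close> on \<open>\<real>\<^sup>d\<close>: the product of the Lebesgue--Stieltjes measures \<open>dF\<^sub>i\<close>,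
  transported from functions on the index type to vectors.\<close>

definition joint_law :: "('n::finite \<Rightarrow> real \<Rightarrow> real) \<Rightarrow> (real^'n) measure" where
  "joint_law F = distr (PiM UNIV (\<lambda>i. interval_measure (F i))) borel (\<lambda>x. \<chi> i. x i)"

text \<open>Existence of continuous second-order partial derivatives: \<open>g i\<close> is the partial derivative
  of \<open>f\<close> in direction \<open>i\<close>, and \<open>h i j\<close> that of \<open>g i\<close> in direction \<open>j\<close>.\<close>

definition has_partial :: "(real^'n::finite \<Rightarrow> real) \<Rightarrow> 'n \<Rightarrow> (real^'n \<Rightarrow> real) \<Rightarrow> bool" where
  "has_partial f i g \<longleftrightarrow>
     (\<forall>z. ((\<lambda>t. f (z + t *\<^sub>R axis i 1)) has_real_derivative g z) (at 0))"

definition continuous_second_partials :: "(real^'n::finite \<Rightarrow> real) \<Rightarrow> bool" where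
  "continuous_second_partials f \<longleftrightarrow>
     (\<exists>g h. \<forall>i. has_partial f i (g i) \<and>
        (\<forall>j. has_partial (g i) j (h i j) \<and> continuous_on UNIV (h i j)))"

text \<open>The vector whose \<open>i\<close>th component is \<open>t\<close> and whose other components are those of \<open>z\<close>.\<close>

definition replace_comp :: "'n::finite \<Rightarrow> real \<Rightarrow> real^'n \<Rightarrow> real^'n" where
  "replace_comp i t z = (\<chi> j. if j = i then t else z $ j)"

definition upper_sobol :: "('n::finite \<Rightarrow> real \<Rightarrow> real) \<Rightarrow> (real^'n \<Rightarrow> real) \<Rightarrow> 'n \<Rightarrow> real" where
  "upper_sobol F f i =
     1 / (2 * prob_space.variance (joint_law F) f) *
     (\<integral>(z, t). (f z - f (replace_comp i t z))\<^sup>2 \<partial>(joint_law F \<Otimes>\<^sub>M interval_measure (F i)))"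

text \<open>On the null set \<open>t = z $ i\<close> the quotient takes the conventional value 0.\<close>

definition diff_quot :: "(real^'n::finite \<Rightarrow> real) \<Rightarrow> 'n \<Rightarrow> real \<Rightarrow> real^'n \<Rightarrow> real" where
  "diff_quot f i t z = (f (replace_comp i t z) - f z) / (t - z $ i)"

definition diff_quot_vec :: "(real^'n::finite \<Rightarrow> real) \<Rightarrow> real^'n \<Rightarrow> real^'n \<Rightarrow> real^'n" where
  "diff_quot_vec f v z = (\<chi> i. diff_quot f i (v $ i) z)"

text \<open>The independent pair \<open>(z, v)\<close> is realised by the coordinates of \<open>pair_law F\<close>;
  \<open>sigma_first F\<close> is the sub-sigma-algebra generated by \<open>z\<close>.\<close>

definition pair_law :: "('n::finite \<Rightarrow> real \<Rightarrow> real) \<Rightarrow> ((real^'n) \<times> (real^'n)) measure" where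
  "pair_law F = joint_law F \<Otimes>\<^sub>M joint_law F"

definition sigma_first :: "('n::finite \<Rightarrow> real \<Rightarrow> real) \<Rightarrow> ((real^'n) \<times> (real^'n)) measure" where
  "sigma_first F = vimage_algebra (space (pair_law F)) fst (joint_law F)"

definition gas_entry :: "(real^'n::finite \<Rightarrow> real) \<Rightarrow> 'n \<Rightarrow> 'n \<Rightarrow> (real^'n) \<times> (real^'n) \<Rightarrow> real" where
  "gas_entry f i j = (\<lambda>(z, v). diff_quot_vec f v z $ i * diff_quot_vec f v z $ j)"

definition C_gas :: "('n::finite \<Rightarrow> real \<Rightarrow> real) \<Rightarrow> (real^'n \<Rightarrow> real) \<Rightarrow> real^'n^'n" where
  "C_gas F f = (\<chi> i j. prob_space.expectation (pair_law F)
     (real_cond_exp (pair_law F) (sigma_first F) (gas_entry f i j)))"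

text \<open>\<open>C = U \<Lambda> U\<^sup>T\<close> with \<open>U\<close> orthogonal and \<open>\<Lambda> = diag(l)\<close>. Rows and columns are indexed by the
  type \<open>'n\<close>; \<open>idx\<close> numbers the indices as \<open>1, \<dots>, d\<close>, so that \<open>\<lambda>\<^sub>j\<close> is \<open>l $ idx j\<close> and the
  eigenvector \<open>u\<^sub>j\<close> is the column of \<open>U\<close> with index \<open>idx j\<close>.\<close>

definition eigen_decomposition ::
  "(nat \<Rightarrow> 'n::finite) \<Rightarrow> real^'n^'n \<Rightarrow> real^'n^'n \<Rightarrow> real^'n \<Rightarrow> bool" where
  "eigen_decomposition idx C U l \<longleftrightarrow>
     bij_betw idx {1..CARD('n)} UNIV \<and>
     orthogonal_matrix U \<and>
     C = U ** (\<chi> i j. if i = j then l $ i else 0) ** transpose U \<and>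
     (\<forall>j k. 1 \<le> j \<and> j \<le> k \<and> k \<le> CARD('n) \<longrightarrow> l $ idx k \<le> l $ idx j) \<and>
     (\<forall>j. 0 \<le> l $ j)"

definition activity_score :: "(nat \<Rightarrow> 'n::finite) \<Rightarrow> real^'n^'n \<Rightarrow> real^'n \<Rightarrow> 'n \<Rightarrow> nat \<Rightarrow> real" where
  "activity_score idx U l i m = (\<Sum>j=1..m. l $ idx j * (U $ i $ idx j)\<^sup>2)"

definition kappa :: "(real^'n::finite \<Rightarrow> real) \<Rightarrow> real \<Rightarrow> real \<Rightarrow> real \<Rightarrow> real" where
  "kappa f a b \<epsilon> =
     (2 * \<epsilon> - \<epsilon>\<^sup>2) / (b - a)\<^sup>2 * (SUP (z, v)\<in>UNIV. (f z - f v)\<^sup>2)"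

end

theory Submission
  imports Defs
begin

text \<open>
  Fix a coordinate \<open>i\<close> and let \<open>z, v\<close> be independent with law \<open>\<^bold>F\<close>. The numerator of the upper
  Sobol' index is the expectation of the squared increment of \<open>f\<close> when \<open>z\<^sub>i\<close> is replaced by \<open>v\<^sub>i\<close>, and
  this increment is the difference quotient times \<open>v\<^sub>i - z\<^sub>i\<close>. When both \<open>z\<^sub>i\<close> and \<open>v\<^sub>i\<close> lie in
  \<open>(a, b)\<close>, the factor \<open>v\<^sub>i - z\<^sub>i\<close> is at most \<open>b - a\<close> in modulus. Otherwise the squared increment is at
  most the supremum of \<open>(f z - f v)\<^sup>2\<close>, and by independence this event has probability at most
  \<open>1 - (1 - \<epsilon>)\<^sup>2 = 2\<epsilon> - \<epsilon>\<^sup>2\<close>. Taking expectations (\<open>expectation_increment_le\<close>) bounds the numerator by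
  \<open>(b - a)\<^sup>2 (C\<^sub>i\<^sub>i + \<kappa>)\<close>, where \<open>C\<^sub>i\<^sub>i\<close> is the diagonal entry of \<open>C_gas\<close>: the expected square of the
  difference quotient.

  It remains to compare this entry with the activity score, which is linear algebra
  (\<open>diagonal_entry_le_activity_score\<close>): \<open>C\<^sub>i\<^sub>i\<close> is the sum of all \<open>\<lambda>\<^sub>j u\<^sub>i\<^sub>j\<^sup>2\<close>, its first \<open>m\<close> terms form
  the score, and in the remaining terms \<open>\<lambda>\<^sub>j \<le> \<lambda>\<^sub>m\<^sub>+\<^sub>1\<close> while the squares of a row of an orthogonal
  matrix add up to 1.
\<close>

section \<open>Integrals under a change of variables\<close>

text \<open>If \<open>g\<close> is integrable, this is monotonicity after the change of variables. If it is not, its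
  Bochner integral is 0, which lies below the integral of the nonnegative majorant.\<close>

lemma integral_distr_le:
  fixes g :: "'b \<Rightarrow> real"
  assumes T: "T \<in> measurable M N"
    and G: "integrable M G"
    and le: "\<And>x. x \<in> space M \<Longrightarrow> g (T x) \<le> G x"
    and nonneg: "\<And>x. x \<in> space M \<Longrightarrow> 0 \<le> G x"
  shows "(\<integral>y. g y \<partial>distr M N T) \<le> (\<integral>x. G x \<partial>M)"
proof (cases "integrable (distr M N T) g")
  case True
  then have "g \<in> borel_measurable N"
    by (auto dest: borel_measurable_integrable)
  then have "(\<integral>y. g y \<partial>distr M N T) = (\<integral>x. g (T x) \<partial>M)"
    using T by (rule integral_distr[rotated])
  also have "\<dots> \<le> (\<integral>x. G x \<partial>M)"
    using G le nonneg by (rule integral_mono')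
  finally show ?thesis .
next
  case False
  then show ?thesis
    using nonneg by (simp add: not_integrable_integral_eq integral_nonneg_AE)
qed

section \<open>The product law and its marginals\<close>

lemma prob_space_interval_measure:
  assumes "is_cdf G"
  shows "prob_space (interval_measure G)"
proof -
  interpret real_distribution "interval_measure G"
    using assms by (intro real_distribution_interval_measure) (auto simp: is_cdf_def mono_def)
  show ?thesis by unfold_locales
qed

lemma borel_measurable_vec_nth: "(\<lambda>z::real^'n::finite. z $ i) \<in> borel_measurable borel"
  by (intro borel_measurable_continuous_onI continuous_intros)

lemma borel_coordinate_slab: "{z::real^'n::finite. z $ i \<in> {a<..<b}} \<in> sets borel"
  using measurable_sets[OF borel_measurable_vec_nth, of "{a<..<b}"] by (simp add: vimage_def)

lemma measurable_vec_lambda_PiM: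
  "(\<lambda>x. \<chi> i. x i) \<in> measurable (PiM UNIV (\<lambda>i::'n::finite. interval_measure (F i)))
     (borel :: (real^'n) measure)"
proof -
  have "(\<lambda>x. x i) \<in> borel_measurable (PiM UNIV (\<lambda>i::'n. interval_measure (F i)))" for i
    using measurable_component_singleton[of i UNIV "\<lambda>i. interval_measure (F i)"]
    by (simp cong: measurable_cong_sets)
  then show ?thesis
    by (subst borel_measurable_euclidean_space) (auto simp: Basis_vec_def inner_axis)
qed

lemma sets_joint_law [simp, measurable_cong]: "sets (joint_law F) = sets borel"
  by (simp add: joint_law_def)

lemma space_joint_law [simp]: "space (joint_law F) = UNIV"
  by (simp add: joint_law_def)

lemma prob_space_joint_law:
  assumes "\<And>i. is_cdf (F i)"
  shows "prob_space (joint_law F)"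
  unfolding joint_law_def
  by (intro prob_space.prob_space_distr prob_space_PiM prob_space_interval_measure assms
      measurable_vec_lambda_PiM)

lemma joint_law_component:
  fixes F :: "'n::finite \<Rightarrow> real \<Rightarrow> real"
  assumes "\<And>i. is_cdf (F i)"
  shows "distr (joint_law F) borel (\<lambda>z. z $ i) = interval_measure (F i)"
proof -
  have "distr (joint_law F) borel (\<lambda>z. z $ i)
      = distr (PiM UNIV (\<lambda>i. interval_measure (F i))) borel (\<lambda>x. x i)"
    unfolding joint_law_def
    by (subst distr_distr[OF borel_measurable_vec_nth measurable_vec_lambda_PiM]) (simp add: comp_def)
  also have "\<dots> = distr (PiM UNIV (\<lambda>i. interval_measure (F i))) (interval_measure (F i)) (\<lambda>x. x i)"
    by (rule distr_cong) auto
  also have "\<dots> = interval_measure (F i)"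
    by (intro distr_PiM_component prob_space_interval_measure assms) simp
  finally show ?thesis .
qed

text \<open>A further scalar distributed as \<open>F i\<close> may be taken to be the \<open>i\<close>th coordinate of an independent
  copy of the vector. This brings the Sobol' index and \<open>C_gas\<close> onto the same probability space.\<close>

lemma joint_law_pair_component:
  fixes F :: "'n::finite \<Rightarrow> real \<Rightarrow> real"
  assumes "\<And>i. is_cdf (F i)"
  shows "joint_law F \<Otimes>\<^sub>M interval_measure (F i)
      = distr (pair_law F) (borel \<Otimes>\<^sub>M borel) (\<lambda>(z, v). (z, v $ i))"
proof -
  have nth: "(\<lambda>z::real^'n. z $ i) \<in> measurable (joint_law F) borel"
    unfolding measurable_cong_sets[OF sets_joint_law refl] by (rule borel_measurable_vec_nth)
  have id: "(\<lambda>z. z) \<in> measurable (joint_law F) borel"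
    by simp
  have component: "distr (joint_law F) borel (\<lambda>z. z $ i) = interval_measure (F i)"
    using assms by (rule joint_law_component)
  have "distr (joint_law F) borel (\<lambda>z. z) = joint_law F"
    by (rule distr_id2) simp
  moreover have "sigma_finite_measure (distr (joint_law F) borel (\<lambda>z. z $ i))"
    unfolding component
    using prob_space_interval_measure[OF assms] prob_space_imp_sigma_finite by blast
  ultimately show ?thesis
    using pair_measure_distr[OF id nth] component by (simp add: pair_law_def)
qed

lemma prob_space_pair_law:
  assumes "\<And>i. is_cdf (F i)"
  shows "prob_space (pair_law F)"
proof -
  interpret prob_space "joint_law F" using prob_space_joint_law[OF assms] .
  interpret pair_prob_space "joint_law F" "joint_law F" ..
  show ?thesis unfolding pair_law_def by unfold_locales
qed

text \<open>The tower property removes the inner conditional expectation.\<close>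

lemma C_gas_entry_eq:
  assumes "\<And>i. is_cdf (F i)" and "integrable (pair_law F) (gas_entry f i j)"
  shows "C_gas F f $ i $ j = (\<integral>x. gas_entry f i j x \<partial>pair_law F)"
proof -
  interpret P: prob_space "pair_law F" using prob_space_pair_law[OF assms(1)] .
  have "fst \<in> measurable (pair_law F) (joint_law F)"
    unfolding pair_law_def by simp
  then have "subalgebra (pair_law F) (sigma_first F)"
    unfolding subalgebra_def sigma_first_def by (simp add: sets_image_in_sets)
  then interpret finite_measure_subalgebra "pair_law F" "sigma_first F"
    by unfold_locales
  show ?thesis
    using real_cond_exp_int(2)[OF assms(2)] by (simp add: C_gas_def)
qed

section \<open>The increment in one coordinate\<close>

text \<open>At \<open>t = z $ i\<close> both sides vanish, so the conventional value of the quotient does no harm.\<close>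

lemma increment_eq_diff_quot:
  "(f z - f (replace_comp i t z))\<^sup>2 = (t - z $ i)\<^sup>2 * (diff_quot f i t z)\<^sup>2"
proof (cases "t = z $ i")
  case True
  then have "replace_comp i t z = z"
    by (simp add: replace_comp_def vec_eq_iff)
  then show ?thesis using True by simp
next
  case False
  then show ?thesis
    by (simp add: diff_quot_def power_divide power2_commute)
qed

lemma gas_entry_diagonal: "gas_entry f i i (z, v) = (diff_quot f i (v $ i) z)\<^sup>2"
  by (simp add: gas_entry_def diff_quot_vec_def power2_eq_square)

lemma bdd_above_squared_oscillation:
  fixes f :: "'a \<Rightarrow> real"
  assumes "bounded (range f)"
  shows "bdd_above (range (\<lambda>(z, v). (f z - f v)\<^sup>2))"
proof -
  obtain B where B: "\<And>z. \<bar>f z\<bar> \<le> B"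
    using assms unfolding bounded_iff by auto
  have "(f z - f v)\<^sup>2 \<le> (2 * B)\<^sup>2" for z v
  proof -
    have "\<bar>f z - f v\<bar> \<le> 2 * B" using B[of z] B[of v] by linarith
    then show ?thesis by (metis abs_ge_zero power2_abs power_mono)
  qed
  then show ?thesis by (intro bdd_aboveI[of _ "(2 * B)\<^sup>2"]) auto
qed

lemma squared_oscillation_le_SUP:
  fixes f :: "'a \<Rightarrow> real"
  assumes "bounded (range f)"
  shows "(f z - f v)\<^sup>2 \<le> (SUP (z, v)\<in>UNIV. (f z - f v)\<^sup>2)"
  using cSUP_upper[OF _ bdd_above_squared_oscillation[OF assms], of "(z, v)"] by simp

text \<open>\<open>\<kappa>\<close> carries the factor \<open>1 / (b - a)\<^sup>2\<close> exactly so that \<open>(b - a)\<^sup>2\<close> can be taken out of both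
  contributions, the one from the slab \<open>(a, b)\<close> and the one from its complement.\<close>

lemma expectation_increment_le:
  fixes F :: "'n::finite \<Rightarrow> real \<Rightarrow> real" and f :: "real^'n \<Rightarrow> real"
  assumes cdf: "\<And>i. is_cdf (F i)"
    and bounded: "bounded (range f)"
    and int: "integrable (pair_law F) (gas_entry f i i)"
    and ab: "a < b" and eps: "\<epsilon> \<le> 1"
    and prob: "measure (joint_law F) {z. z $ i \<in> {a<..<b}} \<ge> 1 - \<epsilon>"
  shows "(\<integral>(z, t). (f z - f (replace_comp i t z))\<^sup>2 \<partial>(joint_law F \<Otimes>\<^sub>M interval_measure (F i)))
      \<le> (b - a)\<^sup>2 * (C_gas F f $ i $ i + kappa f a b \<epsilon>)"
proof -
  interpret J: prob_space "joint_law F" using prob_space_joint_law[OF cdf] .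
  interpret P: prob_space "pair_law F" using prob_space_pair_law[OF cdf] .
  define A where "A = {z::real^'n. z $ i \<in> {a<..<b}}"
  define S where "S = (SUP (z, v)\<in>UNIV. (f z - f v)\<^sup>2)"
  \<comment> \<open>The first term dominates the squared increment on \<open>A \<times> A\<close>, the second one off it.\<close>
  define G where
    "G x = (b - a)\<^sup>2 * gas_entry f i i x + S * indicator (- (A \<times> A)) x" for x
  have osc: "(f z - f v)\<^sup>2 \<le> S" for z v
    unfolding S_def using bounded by (rule squared_oscillation_le_SUP)
  have S: "0 \<le> S" using osc[of undefined undefined] by simp
  have A: "A \<in> sets (joint_law F)"
    using borel_coordinate_slab by (simp add: A_def)
  then have AA: "A \<times> A \<in> sets (pair_law F)"
    unfolding pair_law_def by (rule pair_measureI[rotated]) (fact A)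
  have space: "space (pair_law F) = UNIV"
    by (simp add: pair_law_def space_pair_measure)
  have compl: "- (A \<times> A) \<in> sets (pair_law F)"
    using sets.compl_sets[OF AA] by (simp add: space Compl_eq_Diff_UNIV)
  have "measure (pair_law F) (A \<times> A) = (measure (joint_law F) A)\<^sup>2"
    using J.emeasure_pair_measure_Times[OF A A]
    by (simp add: measure_def pair_law_def power2_eq_square enn2real_mult)
  \<comment> \<open>Squaring keeps the inequality because \<open>1 - \<epsilon>\<close> is nonnegative.\<close>
  also have "\<dots> \<ge> (1 - \<epsilon>)\<^sup>2"
    using prob eps by (intro power_mono) (auto simp: A_def)
  finally have outside: "measure (pair_law F) (- (A \<times> A)) \<le> 2 * \<epsilon> - \<epsilon>\<^sup>2"
    using P.prob_compl[OF AA] by (simp add: space Compl_eq_Diff_UNIV power2_diff)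
  have int_ind: "integrable (pair_law F) (indicator (- (A \<times> A)) :: _ \<Rightarrow> real)"
    using compl by (simp add: P.emeasure_eq_measure)
  have "(\<integral>(z, t). (f z - f (replace_comp i t z))\<^sup>2 \<partial>(joint_law F \<Otimes>\<^sub>M interval_measure (F i)))
      \<le> (\<integral>x. G x \<partial>pair_law F)"
    unfolding joint_law_pair_component[of F, OF cdf]
  proof (rule integral_distr_le)
    show "(\<lambda>(z, v). (z, v $ i)) \<in> measurable (pair_law F) (borel \<Otimes>\<^sub>M (borel :: real measure))"
      unfolding pair_law_def using borel_measurable_vec_nth by measurable
    show "integrable (pair_law F) G"
      unfolding G_def using int int_ind by simp
    fix x :: "(real^'n) \<times> (real^'n)"
    obtain z v where x: "x = (z, v)" by (cases x)
    have gas: "0 \<le> gas_entry f i i (z, v)" by (simp add: gas_entry_diagonal)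
    then show "0 \<le> G x" using S by (simp add: G_def x)
    show "(case (case x of (z, v) \<Rightarrow> (z, v $ i)) of (z, t) \<Rightarrow> (f z - f (replace_comp i t z))\<^sup>2) \<le> G x"
    proof (cases "z \<in> A \<and> v \<in> A")
      case True
      then have "\<bar>v $ i - z $ i\<bar> \<le> b - a" by (auto simp: A_def)
      then have "(v $ i - z $ i)\<^sup>2 \<le> (b - a)\<^sup>2" by (metis abs_ge_zero power2_abs power_mono)
      then show ?thesis
        using True gas
        by (simp add: x G_def increment_eq_diff_quot gas_entry_diagonal mult_right_mono)
    next
      case False
      moreover have "0 \<le> (b - a)\<^sup>2 * gas_entry f i i (z, v)" using gas by simp
      ultimately show ?thesis
        using osc[of z "replace_comp i (v $ i) z"] by (auto simp: x G_def)
    qed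
  qed
  also have "(\<integral>x. G x \<partial>pair_law F)
      = (b - a)\<^sup>2 * C_gas F f $ i $ i + S * measure (pair_law F) (- (A \<times> A))"
    unfolding G_def using int int_ind compl
    by (simp add: C_gas_entry_eq[OF cdf int] space)
  also have "\<dots> \<le> (b - a)\<^sup>2 * C_gas F f $ i $ i + S * (2 * \<epsilon> - \<epsilon>\<^sup>2)"
    using outside S by (simp add: mult_left_mono)
  also have "\<dots> = (b - a)\<^sup>2 * (C_gas F f $ i $ i + kappa f a b \<epsilon>)"
    using ab by (simp add: kappa_def S_def[symmetric] field_simps)
  finally show ?thesis .
qed

text \<open>A constant \<open>f\<close> has variance 0, so \<open>f\<close> takes two values and the supremum is positive.\<close>

lemma kappa_pos:
  fixes F :: "'n::finite \<Rightarrow> real \<Rightarrow> real" and f :: "real^'n \<Rightarrow> real"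
  assumes cdf: "\<And>i. is_cdf (F i)"
    and bounded: "bounded (range f)"
    and variance: "prob_space.variance (joint_law F) f > 0"
    and eps: "0 < \<epsilon>" "\<epsilon> < 2" and ab: "a < b"
  shows "kappa f a b \<epsilon> > 0"
proof -
  interpret J: prob_space "joint_law F" using prob_space_joint_law[OF cdf] .
  have "\<exists>z v. f z \<noteq> f v"
  proof (rule ccontr)
    assume "\<not> ?thesis"
    then have "f = (\<lambda>_. f undefined)" by auto
    then obtain c where "f = (\<lambda>_. c)" by blast
    then show False using variance J.prob_space by simp
  qed
  then obtain z v where "f z \<noteq> f v" by blast
  then have "0 < (f z - f v)\<^sup>2" by simp
  also have "\<dots> \<le> (SUP (z, v)\<in>UNIV. (f z - f v)\<^sup>2)"
    using bounded by (rule squared_oscillation_le_SUP)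
  finally have "0 < (SUP (z, v)\<in>UNIV. (f z - f v)\<^sup>2)" .
  moreover have "2 * \<epsilon> - \<epsilon>\<^sup>2 > 0"
    using mult_pos_pos[of \<epsilon> "2 - \<epsilon>"] eps by (simp add: power2_eq_square algebra_simps)
  ultimately show ?thesis
    using ab unfolding kappa_def by (intro mult_pos_pos divide_pos_pos) auto
qed

section \<open>The diagonal of the spectral decomposition\<close>

lemma diagonal_entry_spectral:
  fixes U :: "real^'n^'n"
  shows "(U ** (\<chi> i j. if i = j then l $ i else 0) ** transpose U) $ i $ i
      = (\<Sum>j\<in>UNIV. l $ j * (U $ i $ j)\<^sup>2)"
  by (simp add: matrix_matrix_mult_def transpose_def if_distrib[of "\<lambda>x. _ * x"]
      sum.delta power2_eq_square mult_ac cong: if_cong)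

lemma orthogonal_matrix_row_sum_squares:
  fixes U :: "real^'n^'n"
  assumes "orthogonal_matrix U"
  shows "(\<Sum>j\<in>UNIV. (U $ i $ j)\<^sup>2) = 1"
proof -
  have "(U ** transpose U) $ i $ i = 1"
    using assms by (simp add: orthogonal_matrix_def mat_def)
  then show ?thesis
    by (simp add: matrix_matrix_mult_def transpose_def power2_eq_square)
qed

lemma diagonal_entry_le_activity_score:
  fixes C U :: "real^'n^'n"
  assumes dec: "eigen_decomposition idx C U l" and m: "m < CARD('n)"
  shows "C $ i $ i \<le> activity_score idx U l i m + l $ idx (m + 1)"
proof -
  define w where "w j = (U $ i $ idx j)\<^sup>2" for j
  have bij: "bij_betw idx {1..CARD('n)} UNIV"
    and U: "orthogonal_matrix U"
    and C: "C = U ** (\<chi> i j. if i = j then l $ i else 0) ** transpose U"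
    and ord: "\<And>j k. 1 \<le> j \<Longrightarrow> j \<le> k \<Longrightarrow> k \<le> CARD('n) \<Longrightarrow> l $ idx k \<le> l $ idx j"
    and nonneg: "\<And>j. 0 \<le> l $ j"
    using dec unfolding eigen_decomposition_def by blast+
  have split: "{1..CARD('n)} = {1..m} \<union> {m + 1..CARD('n)}" using m by auto
  have "(\<Sum>j = m + 1..CARD('n). w j) \<le> (\<Sum>j = 1..CARD('n). w j)"
    by (rule sum_mono2) (auto simp: w_def)
  also have "\<dots> = 1"
    using sum.reindex_bij_betw[OF bij, of "\<lambda>j. (U $ i $ j)\<^sup>2"]
      orthogonal_matrix_row_sum_squares[OF U, of i] by (simp add: w_def)
  finally have tail: "(\<Sum>j = m + 1..CARD('n). w j) \<le> 1" .
  have "C $ i $ i = (\<Sum>j = 1..CARD('n). l $ idx j * w j)"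
    using sum.reindex_bij_betw[OF bij, of "\<lambda>j. l $ j * (U $ i $ j)\<^sup>2"]
    by (simp add: C diagonal_entry_spectral w_def)
  also have "\<dots> = (\<Sum>j = 1..m. l $ idx j * w j) + (\<Sum>j = m + 1..CARD('n). l $ idx j * w j)"
    unfolding split by (rule sum.union_disjoint) auto
  also have "(\<Sum>j = m + 1..CARD('n). l $ idx j * w j)
      \<le> (\<Sum>j = m + 1..CARD('n). l $ idx (m + 1) * w j)"
    by (intro sum_mono mult_right_mono ord) (auto simp: w_def)
  also have "\<dots> = l $ idx (m + 1) * (\<Sum>j = m + 1..CARD('n). w j)"
    by (simp add: sum_distrib_left)
  also have "\<dots> \<le> l $ idx (m + 1)"
    using tail nonneg by (simp add: mult_left_le)
  finally show ?thesis by (simp add: activity_score_def w_def)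
qed

section \<open>The bound on the upper Sobol' index\<close>

theorem corollary3p6:
  fixes F :: "'n::finite \<Rightarrow> real \<Rightarrow> real"
    and f :: "real^'n \<Rightarrow> real"
    and idx :: "nat \<Rightarrow> 'n"
    and U :: "real^'n^'n"
    and l :: "real^'n"
    and a' b' \<epsilon> :: real
  assumes d: "CARD('n) \<ge> 2"
    and marginals: "\<And>i. is_cdf (F i)"
    and continuous_F: "continuous_on UNIV (joint_cdf F)"
    and bounded_f: "bounded (range f)"
    and square_integrable_f: "integrable (joint_law F) (\<lambda>z. (f z)\<^sup>2)"
    and C2_f: "continuous_second_partials f"
    and variance_pos: "prob_space.variance (joint_law F) f > 0"
    and C_gas_finite: "\<And>i j. integrable (pair_law F) (gas_entry f i j)"
    and decomposition: "eigen_decomposition idx (C_gas F f) U l"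
    and eps: "0 < \<epsilon>" "\<epsilon> < 1"
    and ab: "a' < b'"
    and cube: "measure (joint_law F) {z. \<forall>i. z $ i \<in> {a'<..<b'}} = 1 - \<epsilon>"
  shows "kappa f a' b' \<epsilon> > 0 \<and>
    (\<forall>m i. 1 \<le> m \<and> m \<le> CARD('n) - 1 \<longrightarrow>
      upper_sobol F f i \<le>
        (b' - a')\<^sup>2 / 2 *
        ((activity_score idx U l i m + l $ idx (m + 1) + kappa f a' b' \<epsilon>)
          / prob_space.variance (joint_law F) f))"
proof (intro conjI allI impI)
  show "kappa f a' b' \<epsilon> > 0"
    using marginals bounded_f variance_pos eps ab by (intro kappa_pos) auto
next
  fix m i
  assume m: "1 \<le> m \<and> m \<le> CARD('n) - 1"
  interpret J: prob_space "joint_law F" using prob_space_joint_law[OF marginals] .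
  let ?V = "prob_space.variance (joint_law F) f"
  let ?B = "activity_score idx U l i m + l $ idx (m + 1) + kappa f a' b' \<epsilon>"
  \<comment> \<open>The cube lies in the slab given by its \<open>i\<close>th side, so the slab has at least its mass.\<close>
  have "measure (joint_law F) {z. \<forall>i. z $ i \<in> {a'<..<b'}}
      \<le> measure (joint_law F) {z. z $ i \<in> {a'<..<b'}}"
    using borel_coordinate_slab by (intro J.finite_measure_mono) auto
  then have "1 - \<epsilon> \<le> measure (joint_law F) {z. z $ i \<in> {a'<..<b'}}"
    using cube by simp
  then have "(\<integral>(z, t). (f z - f (replace_comp i t z))\<^sup>2 \<partial>(joint_law F \<Otimes>\<^sub>M interval_measure (F i)))
      \<le> (b' - a')\<^sup>2 * (C_gas F f $ i $ i + kappa f a' b' \<epsilon>)"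
    using eps by (intro expectation_increment_le marginals bounded_f C_gas_finite ab) auto
  also have "\<dots> \<le> (b' - a')\<^sup>2 * ?B"
    using diagonal_entry_le_activity_score[OF decomposition, of m i] d m
    by (intro mult_left_mono) auto
  finally have "upper_sobol F f i \<le> 1 / (2 * ?V) * ((b' - a')\<^sup>2 * ?B)"
    unfolding upper_sobol_def using variance_pos by (intro mult_left_mono) auto
  then show "upper_sobol F f i \<le> (b' - a')\<^sup>2 / 2 * (?B / ?V)"
    by simp
qed

end
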